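(* Let $L$ be a finite-dimensional solvable, $\phi$-free, minimally non-strongly solvable Leibniz algebra over a field $\mathbb{F}$. Then $\mathbb{F}$ has characteristic $p>0$, and $L=A+H$ is a semidirect sum (of an ideal $A$ and a subalgebra $H$), where (1) $A$ is the unique minimal ideal of $L$; (2) $\dim A\ge 2$; (3) $A^2=0$; and (4) either $H=M\dotplus\mathbb{F}x$ (vector space direct sum) for some $x \in H$, where $M$ is a minimal abelian ideal of $H$, or $H$ is the three-dimensional Heisenberg algebra. Moreover, either $L$ is a Lie algebra, or, if not, then $H$ is a Lie algebra, $A=\mathrm{Leib}(L)$, and $AL=0$.
   Context: A (left) Leibniz algebra is an algebra satisfying $a(bc)=(ab)c+b(ac)$; it is a Lie algebra if its product is antisymmetric ($xx=0$ for all $x$). Ideals are two-sided. $\mathrm{Leib}(L)$ is the span of all squares $xx$, $x\in L$. For subspaces $U,V$, $UV$ is the span of the products $uv$, and $U^2=UU$. The Frattini subalgebra of $L$ is the intersection of all maximal subalgebras; the Frattini ideal $\Phi(L)=\phi(L)$ is the largest ideal of $L$ contained in it; $L$ is $\phi$-free if $\phi(L)=0$. $L$ is strongly solvable if $L^2$ is nilpotent. $L$ is minimally non-strongly solvable if $L$ is not strongly solvable but every proper subalgebra of $L$ is. The three-dimensional Heisenberg algebra is the Lie algebra with basis $x,y,z$, $yx=z=-xy$ and $z$ central. *)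

theory Defs
  imports Complex_Main
begin

text \<open>
  The algebra L is the whole type \<open>'a\<close>. Since the notions below are also needed for
  subalgebras of L (regarded as algebras in their own right), each takes as an argument
  the subalgebra \<open>S\<close> with respect to which it is formed; for L itself \<open>S = UNIV\<close>.
\<close>

locale leibniz_algebra = vector_space scale
  for scale :: "'k::field \<Rightarrow> 'a::ab_group_add \<Rightarrow> 'a" (infixr "*s" 75) +
  fixes mult :: "'a \<Rightarrow> 'a \<Rightarrow> 'a" (infixl "\<cdot>" 70)
  assumes linear_mult_right: "Vector_Spaces.linear scale scale (\<lambda>b. a \<cdot> b)"
    and linear_mult_left: "Vector_Spaces.linear scale scale (\<lambda>a. a \<cdot> b)"
    and leibniz: "a \<cdot> (b \<cdot> c) = (a \<cdot> b) \<cdot> c + b \<cdot> (a \<cdot> c)"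
begin

definition subalgebra :: "'a set \<Rightarrow> bool" where
  "subalgebra S \<longleftrightarrow> subspace S \<and> (\<forall>a\<in>S. \<forall>b\<in>S. a \<cdot> b \<in> S)"

definition ideal :: "'a set \<Rightarrow> 'a set \<Rightarrow> bool" where
  "ideal S I \<longleftrightarrow> subspace I \<and> I \<subseteq> S \<and> (\<forall>s\<in>S. \<forall>i\<in>I. s \<cdot> i \<in> I \<and> i \<cdot> s \<in> I)"

definition minimal_ideal :: "'a set \<Rightarrow> 'a set \<Rightarrow> bool" where
  "minimal_ideal S I \<longleftrightarrow> ideal S I \<and> I \<noteq> {0} \<and> (\<forall>J. ideal S J \<and> J \<subseteq> I \<longrightarrow> J = {0} \<or> J = I)"

definition set_prod :: "'a set \<Rightarrow> 'a set \<Rightarrow> 'a set" where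
  "set_prod U V = span {u \<cdot> v | u v. u \<in> U \<and> v \<in> V}"

definition lie :: "'a set \<Rightarrow> bool" where
  "lie S \<longleftrightarrow> (\<forall>x\<in>S. x \<cdot> x = 0)"

definition Leib :: "'a set \<Rightarrow> 'a set" where
  "Leib S = span {x \<cdot> x | x. x \<in> S}"

primrec derived_series :: "'a set \<Rightarrow> nat \<Rightarrow> 'a set" where
  "derived_series S 0 = S"
| "derived_series S (Suc n) = set_prod (derived_series S n) (derived_series S n)"

definition solvable :: "'a set \<Rightarrow> bool" where
  "solvable S \<longleftrightarrow> (\<exists>n. derived_series S n = {0})"

text \<open>
  In a left Leibniz algebra \<open>(a \<cdot> b) \<cdot> c = a \<cdot> (b \<cdot> c) - b \<cdot> (a \<cdot> c)\<close>, so right-normed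
  products span all products of a given length and multiplying by \<open>S\<close> from the left suffices.
\<close>
primrec lower_central_series :: "'a set \<Rightarrow> nat \<Rightarrow> 'a set" where
  "lower_central_series S 0 = S"
| "lower_central_series S (Suc n) = set_prod S (lower_central_series S n)"

definition nilpotent :: "'a set \<Rightarrow> bool" where
  "nilpotent S \<longleftrightarrow> (\<exists>n. lower_central_series S n = {0})"

definition strongly_solvable :: "'a set \<Rightarrow> bool" where
  "strongly_solvable S \<longleftrightarrow> nilpotent (set_prod S S)"

definition minimally_non_strongly_solvable :: "'a set \<Rightarrow> bool" where
  "minimally_non_strongly_solvable S \<longleftrightarrow>
     \<not> strongly_solvable S \<and> (\<forall>T. subalgebra T \<and> T \<subset> S \<longrightarrow> strongly_solvable T)"

definition maximal_subalgebra :: "'a set \<Rightarrow> 'a set \<Rightarrow> bool" where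
  "maximal_subalgebra S M \<longleftrightarrow>
     subalgebra M \<and> M \<subset> S \<and> (\<forall>T. subalgebra T \<and> M \<subseteq> T \<and> T \<subseteq> S \<longrightarrow> T = M \<or> T = S)"

definition frattini_subalgebra :: "'a set \<Rightarrow> 'a set" where
  "frattini_subalgebra S = S \<inter> \<Inter>{M. maximal_subalgebra S M}"

definition frattini_ideal :: "'a set \<Rightarrow> 'a set" where
  "frattini_ideal S = (GREATEST I. ideal S I \<and> I \<subseteq> frattini_subalgebra S)"

lemma frattini_ideal_greatest:
  assumes S: "subalgebra S"
  shows "ideal S (frattini_ideal S) \<and> frattini_ideal S \<subseteq> frattini_subalgebra S \<and>
    (\<forall>I. ideal S I \<and> I \<subseteq> frattini_subalgebra S \<longrightarrow> I \<subseteq> frattini_ideal S)"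
proof -
  interpret r: Vector_Spaces.linear scale scale "\<lambda>b. a \<cdot> b" for a by (rule linear_mult_right)
  interpret l: Vector_Spaces.linear scale scale "\<lambda>a. a \<cdot> b" for b by (rule linear_mult_left)
  let ?P = "\<lambda>I. ideal S I \<and> I \<subseteq> frattini_subalgebra S"
  define G where "G = span (\<Union>{I. ?P I})"
  have F: "subspace (frattini_subalgebra S)"
    using S unfolding frattini_subalgebra_def maximal_subalgebra_def subalgebra_def
    by (intro subspace_inter subspace_Inter) auto
  have sub: "subspace S" using S by (simp add: subalgebra_def)
  have G1: "G \<subseteq> frattini_subalgebra S"
    unfolding G_def by (rule span_minimal[OF _ F]) auto
  have G2: "G \<subseteq> S" using G1 by (auto simp: frattini_subalgebra_def)
  have mult_G: "s \<cdot> g \<in> G \<and> g \<cdot> s \<in> G" if s: "s \<in> S" and g: "g \<in> G" for s g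
    using g unfolding G_def
  proof (induction rule: span_induct_alt)
    case base
    show ?case by (simp add: r.zero l.zero span_zero)
  next
    case (step c x y)
    from step(1) obtain I where I: "?P I" "x \<in> I" by auto
    then have "s \<cdot> x \<in> I" "x \<cdot> s \<in> I" using s by (auto simp: ideal_def)
    with I(1) have "s \<cdot> x \<in> span (\<Union>{I. ?P I})" "x \<cdot> s \<in> span (\<Union>{I. ?P I})"
      by (auto intro!: span_base)
    with step show ?case by (simp add: r.add r.scale l.add l.scale span_add span_scale)
  qed
  have PG: "?P G" using G1 G2 mult_G by (simp add: ideal_def) (simp add: G_def)
  have ub: "I \<subseteq> G" if "?P I" for I
    using that unfolding G_def by (auto intro: span_base)
  have "frattini_ideal S = G"
    unfolding frattini_ideal_def by (rule Greatest_equality) (use PG ub in auto)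
  with PG ub show ?thesis by simp
qed

definition phi_free :: "'a set \<Rightarrow> bool" where
  "phi_free S \<longleftrightarrow> frattini_ideal S = {0}"

definition direct_sum :: "'a set \<Rightarrow> 'a set \<Rightarrow> 'a set \<Rightarrow> bool" where
  "direct_sum W U V \<longleftrightarrow>
     subspace U \<and> subspace V \<and> W = {u + v | u v. u \<in> U \<and> v \<in> V} \<and> U \<inter> V = {0}"

definition semidirect_sum :: "'a set \<Rightarrow> 'a set \<Rightarrow> 'a set \<Rightarrow> bool" where
  "semidirect_sum S A H \<longleftrightarrow> ideal S A \<and> subalgebra H \<and> direct_sum S A H"

definition heisenberg :: "'a set \<Rightarrow> bool" where
  "heisenberg H \<longleftrightarrow> subalgebra H \<and> lie H \<and>
     (\<exists>x y z. distinct [x, y, z] \<and> independent {x, y, z} \<and> span {x, y, z} = H \<and>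
        y \<cdot> x = z \<and> x \<cdot> y = - z \<and> (\<forall>h\<in>H. z \<cdot> h = 0 \<and> h \<cdot> z = 0))"

end

end

theory Submission
  imports Defs "HOL-Computational_Algebra.Polynomial"
begin

text \<open>
  If \<open>I\<close> is a nonzero ideal, \<open>\<phi>\<close>-freeness gives a maximal, hence strongly solvable, subalgebra \<open>M\<close>
  with \<open>I + M = L\<close>, so the lower central series of \<open>L\<^sup>2\<close> eventually falls into \<open>I\<close>. Two nonzero
  ideals therefore cannot meet trivially, and \<open>L\<close> has a least nonzero ideal \<open>A\<close>, which is abelian
  and complemented by a subalgebra \<open>H\<close>. Minimality of \<open>A\<close> makes \<open>H\<close> act faithfully and irreducibly
  on \<open>A\<close> from the left, so \<open>H\<close> is a Lie algebra.

  The square of a proper subalgebra of \<open>H\<close> acts nilpotently on \<open>A\<close>, hence contains no nonzero ideal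
  of \<open>H\<close>. Thus proper ideals of \<open>H\<close> are abelian and \<open>H = N + Fx\<close> for an abelian ideal \<open>N\<close> whose
  proper \<open>x\<close>-invariant subspaces are killed by \<open>x\<close>. Either \<open>xN = N\<close>, and \<open>N\<close> is a minimal
  ideal, or \<open>x(xN) = 0\<close>, and \<open>H\<close> is the Heisenberg algebra.

  For \<open>n \<in> N\<close> the generalised kernel of \<open>y = xn\<close> on \<open>A\<close> is a submodule, so \<open>y\<close> acts nilpotently or
  injectively. If \<open>p\<close> is the minimal polynomial of \<open>n\<close> on \<open>A\<close>, commuting \<open>p(n) = 0\<close> with \<open>x\<close> gives
  \<open>p'(n) y = 0\<close>, so in characteristic 0 no \<open>y\<close> is injective. The commuting nilpotent maps \<open>xn\<close> then
  have a common kernel, which is all of \<open>A\<close>, contradicting that \<open>H\<close> is not abelian.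
\<close>

section \<open>Sums and products of subspaces, ideals and series\<close>

context leibniz_algebra
begin

lemma mult_bilinear [simp]:
  shows mult_add_right: "a \<cdot> (b + c) = a \<cdot> b + a \<cdot> c"
    and mult_add_left: "(a + b) \<cdot> c = a \<cdot> c + b \<cdot> c"
    and mult_zero_right: "a \<cdot> 0 = 0"
    and mult_zero_left: "0 \<cdot> a = 0"
    and mult_scale_right: "a \<cdot> (k *s b) = k *s (a \<cdot> b)"
    and mult_scale_left: "(k *s a) \<cdot> b = k *s (a \<cdot> b)"
    and mult_minus_right: "a \<cdot> (- b) = - (a \<cdot> b)"
    and mult_minus_left: "(- a) \<cdot> b = - (a \<cdot> b)"
    and mult_diff_right: "a \<cdot> (b - c) = a \<cdot> b - a \<cdot> c"
    and mult_diff_left: "(a - b) \<cdot> c = a \<cdot> c - b \<cdot> c"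
proof -
  interpret r: Vector_Spaces.linear scale scale "\<lambda>b. a \<cdot> b" for a by (rule linear_mult_right)
  interpret l: Vector_Spaces.linear scale scale "\<lambda>a. a \<cdot> b" for b by (rule linear_mult_left)
  show "a \<cdot> (b + c) = a \<cdot> b + a \<cdot> c" "(a + b) \<cdot> c = a \<cdot> c + b \<cdot> c"
    "a \<cdot> 0 = 0" "0 \<cdot> a = 0" "a \<cdot> (k *s b) = k *s (a \<cdot> b)" "(k *s a) \<cdot> b = k *s (a \<cdot> b)"
    "a \<cdot> (- b) = - (a \<cdot> b)" "(- a) \<cdot> b = - (a \<cdot> b)"
    "a \<cdot> (b - c) = a \<cdot> b - a \<cdot> c" "(a - b) \<cdot> c = a \<cdot> c - b \<cdot> c"
    by (simp_all add: r.add l.add r.zero l.zero r.scale l.scale r.neg l.neg r.diff l.diff)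
qed

lemma leibniz_left: "(a \<cdot> b) \<cdot> c = a \<cdot> (b \<cdot> c) - b \<cdot> (a \<cdot> c)"
  by (simp add: leibniz[of a b c])

lemma subspace_mult_preimages:
  assumes "subspace W"
  shows subspace_left_preimage: "subspace {w. s \<cdot> w \<in> W}"
    and subspace_right_preimage: "subspace {w. w \<cdot> s \<in> W}"
  using assms by (auto simp: subspace_def)

definition sum_space :: "'a set \<Rightarrow> 'a set \<Rightarrow> 'a set" where
  "sum_space U V = {u + v | u v. u \<in> U \<and> v \<in> V}"

lemma sum_spaceI: "u \<in> U \<Longrightarrow> v \<in> V \<Longrightarrow> u + v \<in> sum_space U V"
  by (auto simp: sum_space_def)

lemma sum_spaceE:
  assumes "w \<in> sum_space U V"
  obtains u v where "w = u + v" "u \<in> U" "v \<in> V"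
  using assms by (auto simp: sum_space_def)

lemma subspace_sum_space: "subspace U \<Longrightarrow> subspace V \<Longrightarrow> subspace (sum_space U V)"
  unfolding sum_space_def by (rule subspace_sums)

lemma sum_space_mono: "V \<subseteq> V' \<Longrightarrow> sum_space U V \<subseteq> sum_space U V'"
  by (auto simp: sum_space_def)

lemma sum_space_upper1: "subspace V \<Longrightarrow> U \<subseteq> sum_space U V"
  using sum_spaceI[of _ U 0 V] subspace_0 by auto

lemma sum_space_upper2: "subspace U \<Longrightarrow> V \<subseteq> sum_space U V"
  using sum_spaceI[of 0 U _ V] subspace_0 by auto

lemma set_prodI: "u \<in> U \<Longrightarrow> v \<in> V \<Longrightarrow> u \<cdot> v \<in> set_prod U V"
  by (auto simp: set_prod_def intro!: span_base)

lemma subspace_set_prod [simp]: "subspace (set_prod U V)"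
  by (simp add: set_prod_def)

lemma set_prod_least:
  "subspace W \<Longrightarrow> (\<And>u v. u \<in> U \<Longrightarrow> v \<in> V \<Longrightarrow> u \<cdot> v \<in> W) \<Longrightarrow> set_prod U V \<subseteq> W"
  unfolding set_prod_def by (rule span_minimal) auto

lemma set_prod_mono: "U \<subseteq> U' \<Longrightarrow> V \<subseteq> V' \<Longrightarrow> set_prod U V \<subseteq> set_prod U' V'"
  by (rule set_prod_least) (auto intro: set_prodI)

lemma set_prod_eq_0_iff: "set_prod U V = {0} \<longleftrightarrow> (\<forall>u\<in>U. \<forall>v\<in>V. u \<cdot> v = 0)"
proof
  assume "set_prod U V = {0}"
  then show "\<forall>u\<in>U. \<forall>v\<in>V. u \<cdot> v = 0" using set_prodI[of _ U _ V] by auto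
next
  assume "\<forall>u\<in>U. \<forall>v\<in>V. u \<cdot> v = 0"
  then have "set_prod U V \<subseteq> {0}" by (intro set_prod_least) auto
  then show "set_prod U V = {0}" using subspace_0[OF subspace_set_prod, of U V] by auto
qed

lemma idealD:
  assumes "ideal S I"
  shows "subspace I" "I \<subseteq> S" "s \<in> S \<Longrightarrow> i \<in> I \<Longrightarrow> s \<cdot> i \<in> I" "s \<in> S \<Longrightarrow> i \<in> I \<Longrightarrow> i \<cdot> s \<in> I"
  using assms by (auto simp: ideal_def)

text \<open>Left multiplication is a derivation, and \<open>leibniz_left\<close> rewrites a right
  multiple of \<open>u \<cdot> v\<close> as a difference of products of elements of
  \<open>I\<close>.\<close>

lemma ideal_set_prod:
  assumes I: "ideal S I"
  shows "ideal S (set_prod I I)"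
proof -
  have "set_prod I I \<subseteq> I"
    using I by (intro set_prod_least) (auto simp: ideal_def)
  moreover have "set_prod I I \<subseteq> {w. s \<cdot> w \<in> set_prod I I} \<inter> {w. w \<cdot> s \<in> set_prod I I}"
    if s: "s \<in> S" for s
  proof (rule set_prod_least)
    fix u v assume uv: "u \<in> I" "v \<in> I"
    have "s \<cdot> (u \<cdot> v) \<in> set_prod I I"
      unfolding leibniz[of s] using uv s idealD[OF I]
      by (intro subspace_add set_prodI subspace_set_prod) auto
    moreover have "u \<cdot> v \<cdot> s \<in> set_prod I I"
      unfolding leibniz_left[of u] using uv s idealD[OF I]
      by (intro subspace_diff set_prodI subspace_set_prod) auto
    ultimately show "u \<cdot> v \<in> {w. s \<cdot> w \<in> set_prod I I} \<inter> {w. w \<cdot> s \<in> set_prod I I}" by simp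
  qed (intro subspace_inter subspace_mult_preimages subspace_set_prod)
  ultimately show ?thesis using idealD(2)[OF I] by (auto simp: ideal_def)
qed

lemma mult_sum_space:
  assumes "ideal UNIV I" "u \<in> sum_space I U" "v \<in> sum_space I V"
  shows "u \<cdot> v \<in> sum_space I (set_prod U V)"
proof -
  from assms obtain i m j k where *: "u = i + m" "v = j + k" "i \<in> I" "m \<in> U" "j \<in> I" "k \<in> V"
    by (elim sum_spaceE)
  have "i \<cdot> v + m \<cdot> j \<in> I"
    using * assms(1) by (auto simp: ideal_def intro!: subspace_add)
  moreover have "m \<cdot> k \<in> set_prod U V" using * by (intro set_prodI)
  moreover have "u \<cdot> v = (i \<cdot> v + m \<cdot> j) + m \<cdot> k" using * by (simp add: algebra_simps)
  ultimately show ?thesis by (simp add: sum_spaceI)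
qed

lemma set_prod_sum_space:
  assumes "ideal UNIV I" "U' \<subseteq> sum_space I U" "V' \<subseteq> sum_space I V"
  shows "set_prod U' V' \<subseteq> sum_space I (set_prod U V)"
  using assms(2,3) mult_sum_space[OF assms(1)] idealD(1)[OF assms(1)]
  by (intro set_prod_least subspace_sum_space) (simp_all add: subset_iff)

text \<open>Products respect inclusion modulo \<open>I\<close>. Used with the square of the whole
  algebra as \<open>S'\<close> and the square of a supplement of \<open>I\<close> as
  \<open>S\<close>.\<close>

lemma lower_central_series_sum_space:
  assumes "ideal UNIV I" "S' \<subseteq> sum_space I S"
  shows "lower_central_series S' n \<subseteq> sum_space I (lower_central_series S n)"
  by (induction n) (use assms set_prod_sum_space in simp_all)

lemma lower_central_series_subset_ideal:
  assumes "ideal UNIV I" "lower_central_series S m \<subseteq> I"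
  shows "lower_central_series S (m + n) \<subseteq> I"
proof (induction n)
  case (Suc n)
  have "set_prod S (lower_central_series S (m + n)) \<subseteq> I"
    using Suc assms(1) by (intro set_prod_least) (auto simp: ideal_def)
  then show ?case by simp
qed (use assms in simp)

lemma subalgebra_ideal_sum:
  assumes I: "ideal UNIV I" and M: "subalgebra M"
  shows "subalgebra (sum_space I M)"
proof -
  have "set_prod M M \<subseteq> M" using M by (intro set_prod_least) (auto simp: subalgebra_def)
  then have "sum_space I (set_prod M M) \<subseteq> sum_space I M" by (rule sum_space_mono)
  then show ?thesis
    using I M mult_sum_space[OF I, of _ M _ M] idealD(1)[OF I]
    by (auto simp: subalgebra_def intro: subspace_sum_space)
qed

text \<open>A set inside its own square stays inside every term of the derived series.\<close>

lemma solvable_perfect_subset: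
  assumes "solvable UNIV" "S \<subseteq> set_prod S S"
  shows "S \<subseteq> {0}"
proof -
  have "S \<subseteq> derived_series UNIV n" for n
  proof (induction n)
    case (Suc n)
    then show ?case using set_prod_mono[OF Suc Suc] assms(2) by simp
  qed simp
  then show ?thesis using assms(1) unfolding solvable_def by metis
qed

lemma ideal_inter: "ideal S I \<Longrightarrow> ideal S J \<Longrightarrow> ideal S (I \<inter> J)"
  by (auto simp: ideal_def intro: subspace_inter)

section \<open>The ideal spanned by squares, and antisymmetry\<close>

lemma Leib_mult:
  assumes "w \<in> Leib S"
  shows "w \<cdot> l = 0"
proof -
  \<comment> \<open>By \<open>leibniz_left\<close>, \<open>(x \<cdot> x) \<cdot> l\<close> is a
    difference of two equal terms.\<close>
  have "Leib S \<subseteq> {w. w \<cdot> l \<in> {0}}"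
    unfolding Leib_def
    by (intro span_minimal subspace_right_preimage subspace_single_0) (auto simp: leibniz_left)
  then show ?thesis using assms by auto
qed

text \<open>Polarisation: \<open>l \<cdot> (y \<cdot> y)\<close> is the mixed term in the square of
  \<open>l \<cdot> y + y\<close>. Right multiples vanish by \<open>Leib_mult\<close>.\<close>

lemma ideal_Leib: "ideal UNIV (Leib UNIV)"
proof -
  have sq: "x \<cdot> x \<in> Leib UNIV" for x by (auto simp: Leib_def intro!: span_base)
  have sub: "subspace (Leib UNIV)" by (simp add: Leib_def)
  have "l \<cdot> (y \<cdot> y) \<in> Leib UNIV" for l y
  proof -
    have "l \<cdot> (y \<cdot> y) = (l \<cdot> y + y) \<cdot> (l \<cdot> y + y) - (l \<cdot> y) \<cdot> (l \<cdot> y) - y \<cdot> y"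
      by (simp add: leibniz[of l y y] algebra_simps)
    also have "\<dots> \<in> Leib UNIV" by (intro subspace_diff sub sq)
    finally show ?thesis .
  qed
  then have "Leib UNIV \<subseteq> {w. l \<cdot> w \<in> Leib UNIV}" for l
    by (subst Leib_def, intro span_minimal subspace_left_preimage sub) auto
  then show ?thesis using sub by (auto simp: ideal_def Leib_mult subspace_0)
qed

lemma lie_antisym:
  assumes "lie S" "subspace S" "x \<in> S" "y \<in> S"
  shows "x \<cdot> y = - (y \<cdot> x)"
proof -
  have "(x + y) \<cdot> (x + y) = 0" "x \<cdot> x = 0" "y \<cdot> y = 0"
    using assms subspace_add[OF assms(2-4)] unfolding lie_def by blast+
  then show ?thesis by (simp add: eq_neg_iff_add_eq_0 add.commute add.left_commute)
qed

section \<open>Polynomials in a left multiplication\<close>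

definition poly_act :: "'a \<Rightarrow> 'k poly \<Rightarrow> 'a \<Rightarrow> 'a" where
  "poly_act n p a = (\<Sum>i\<le>degree p. coeff p i *s ((\<cdot>) n ^^ i) a)"

lemma poly_act_eq:
  assumes "degree p \<le> N"
  shows "poly_act n p a = (\<Sum>i\<le>N. coeff p i *s ((\<cdot>) n ^^ i) a)"
  unfolding poly_act_def
  using assms by (intro sum.mono_neutral_left) (auto simp: coeff_eq_0)

lemma mult_sum_right: "n \<cdot> (\<Sum>i\<in>I. f i) = (\<Sum>i\<in>I. n \<cdot> f i)"
  by (induction I rule: infinite_finite_induct) simp_all

lemma poly_act_0 [simp]: "poly_act n 0 a = 0"
  by (simp add: poly_act_def)

lemma poly_act_pCons [simp]: "poly_act n (pCons c p) a = c *s a + n \<cdot> poly_act n p a"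
proof -
  have "poly_act n (pCons c p) a = (\<Sum>i\<le>Suc (degree p). coeff (pCons c p) i *s ((\<cdot>) n ^^ i) a)"
    by (rule poly_act_eq) (rule degree_pCons_le)
  also have "\<dots> = c *s a + n \<cdot> poly_act n p a"
    by (subst sum.atMost_Suc_shift) (simp add: poly_act_def mult_sum_right)
  finally show ?thesis .
qed

lemma poly_act_add: "poly_act n (p + q) a = poly_act n p a + poly_act n q a"
proof -
  let ?N = "max (degree p) (degree q)"
  show ?thesis
    using poly_act_eq[of "p + q" ?N] poly_act_eq[of p ?N] poly_act_eq[of q ?N] degree_add_le_max[of p q]
    by (simp add: scale_left_distrib sum.distrib)
qed

lemma poly_act_smult: "poly_act n (smult c p) a = c *s poly_act n p a"
  by (induction p) (simp_all add: scale_right_distrib)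

lemma poly_act_mult: "poly_act n (p * q) a = poly_act n p (poly_act n q a)"
  by (induction p) (simp_all add: poly_act_add poly_act_smult)

lemma poly_act_add_right: "poly_act n p (a + b) = poly_act n p a + poly_act n p b"
  by (induction p) (simp_all add: scale_right_distrib)

lemma poly_act_scale_right: "poly_act n p (c *s a) = c *s poly_act n p a"
  by (induction p) (simp_all add: scale_right_distrib mult.commute)

lemma subspace_poly_act_kernel: "subspace {a. poly_act n p a = 0}"
proof -
  have "poly_act n p 0 = 0" using poly_act_scale_right[of n p 0 0] by simp
  then show ?thesis by (simp add: subspace_def poly_act_add_right poly_act_scale_right)
qed

lemma poly_act_closed:
  assumes "subspace A" "\<And>a. a \<in> A \<Longrightarrow> n \<cdot> a \<in> A" "a \<in> A"
  shows "poly_act n p a \<in> A"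
  by (induction p) (use assms in \<open>simp_all add: subspace_0 subspace_add subspace_scale\<close>)

section \<open>Powers of a left multiplication\<close>

lemma mult_power_add: "((\<cdot>) y ^^ k) (a + b) = ((\<cdot>) y ^^ k) a + ((\<cdot>) y ^^ k) b"
  by (induction k) simp_all

lemma mult_power_scale: "((\<cdot>) y ^^ k) (c *s a) = c *s ((\<cdot>) y ^^ k) a"
  by (induction k) simp_all

lemma mult_power_zero: "((\<cdot>) y ^^ k) 0 = 0"
  by (induction k) simp_all

lemma mult_power_eq_0_mono:
  assumes "((\<cdot>) y ^^ k) a = 0"
  shows "((\<cdot>) y ^^ (m + k)) a = 0"
  by (simp add: funpow_add assms mult_power_zero)

end

section \<open>Annihilating polynomials in finite dimension\<close>

locale fin_dim_leibniz_algebra =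
  leibniz_algebra scale mult + finite_dimensional_vector_space scale Basis
  for scale :: "'k::field \<Rightarrow> 'a::ab_group_add \<Rightarrow> 'a" (infixr "*s" 75)
    and mult :: "'a \<Rightarrow> 'a \<Rightarrow> 'a" (infixl "\<cdot>" 70)
    and Basis :: "'a set"
begin

text \<open>One more iterate of \<open>a\<close> is taken than the dimension: distinct iterates are
  linearly dependent as a set, and a repeated one gives a difference of two monomials.\<close>

lemma vector_annihilating_poly: "\<exists>p. p \<noteq> 0 \<and> poly_act n p a = 0"
proof -
  let ?f = "\<lambda>i. ((\<cdot>) n ^^ i) a"
  define D where "D = card Basis"
  show ?thesis
  proof (cases "inj_on ?f {..D}")
    case True
    have "dependent (?f ` {..D})"
    proof (rule ccontr)
      assume "independent (?f ` {..D})"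
      then have "card (?f ` {..D}) \<le> dim UNIV" by (intro independent_card_le_dim) auto
      then show False using True by (simp add: card_image D_def)
    qed
    then obtain u where u: "\<exists>v\<in>?f ` {..D}. u v \<noteq> 0" "(\<Sum>v\<in>?f ` {..D}. u v *s v) = 0"
      by (auto simp: dependent_finite)
    \<comment> \<open>The dependence \<open>u\<close> is indexed by vectors, so the coefficient of
      degree \<open>i\<close> is read off at the \<open>i\<close>-th iterate.\<close>
    define p where "p = (\<Sum>i\<le>D. monom (u (?f i)) i)"
    have coeff: "coeff p i = u (?f i)" if "i \<le> D" for i
      using that by (simp add: p_def coeff_sum)
    have "degree p \<le> D"
      unfolding p_def by (intro degree_sum_le) (auto intro: order.trans[OF degree_monom_le])
    then have "poly_act n p a = (\<Sum>i\<le>D. u (?f i) *s ?f i)"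
      by (simp add: poly_act_eq[of p D] coeff)
    also have "\<dots> = 0" using u(2) by (simp add: sum.reindex[OF True])
    finally have "poly_act n p a = 0" .
    moreover have "p \<noteq> 0" using u(1) coeff by fastforce
    ultimately show ?thesis by blast
  next
    case False
    then obtain i j where ij: "i \<noteq> j" "?f i = ?f j" by (auto simp: inj_on_def)
    have monom: "poly_act n (monom c k) b = c *s ((\<cdot>) n ^^ k) b" for c k b
      by (induction k) (simp_all add: monom_0 monom_Suc)
    have "poly_act n (monom 1 i + monom (- 1) j) a = 0"
      using ij(2) by (simp add: poly_act_add monom)
    moreover have "coeff (monom 1 i + monom (- 1) j :: 'k poly) i \<noteq> 0"
      using ij(1) by simp
    then have "(monom 1 i + monom (- 1) j :: 'k poly) \<noteq> 0" by (metis coeff_0)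
    ultimately show ?thesis by blast
  qed
qed

text \<open>Polynomials in \<open>n\<close> commute, so the product of those annihilating the single
  basis vectors annihilates them all.\<close>

lemma annihilating_poly: "\<exists>p. p \<noteq> 0 \<and> (\<forall>a. poly_act n p a = 0)"
proof -
  have "\<exists>p. p \<noteq> 0 \<and> (\<forall>b\<in>B. poly_act n p b = 0)" if "finite B" for B
    using that
  proof (induction B)
    case (insert b B)
    then obtain p where p: "p \<noteq> 0" "\<forall>b\<in>B. poly_act n p b = 0" by blast
    obtain q where q: "q \<noteq> 0" "poly_act n q b = 0" using vector_annihilating_poly by blast
    have "poly_act n (p * q) b = 0"
      using q poly_act_scale_right[of n p 0 0] by (simp add: poly_act_mult)
    moreover have "poly_act n (p * q) c = 0" if "c \<in> B" for c
      using that p poly_act_scale_right[of n q 0 0] by (simp add: mult.commute[of p] poly_act_mult)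
    ultimately show ?case using p q by (intro exI[of _ "p * q"]) auto
  qed (auto intro: exI[of _ 1])
  then obtain p where p: "p \<noteq> 0" "\<forall>b\<in>Basis. poly_act n p b = 0" using finite_Basis by blast
  then have "span Basis \<subseteq> {a. poly_act n p a = 0}"
    by (intro span_minimal subspace_poly_act_kernel) auto
  then show ?thesis using p(1) span_Basis by auto
qed

end

section \<open>The least nonzero ideal\<close>

locale minimal_nss_algebra = fin_dim_leibniz_algebra scale mult Basis
  for scale :: "'k::field \<Rightarrow> 'a::ab_group_add \<Rightarrow> 'a" (infixr "*s" 75)
    and mult :: "'a \<Rightarrow> 'a \<Rightarrow> 'a" (infixl "\<cdot>" 70)
    and Basis :: "'a set" +
  assumes solvable: "solvable UNIV"
    and phi_free: "phi_free UNIV"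
    and min_nss: "minimally_non_strongly_solvable UNIV"
begin

text \<open>An ideal inside the Frattini subalgebra would lie in the Frattini ideal, which is zero.
  So some maximal subalgebra does not contain \<open>I\<close>, and maximality makes it a
  supplement.\<close>

lemma ideal_supplement:
  assumes I: "ideal UNIV I" "I \<noteq> {0}"
  obtains M where "subalgebra M" "M \<noteq> UNIV" "\<not> I \<subseteq> M" "sum_space I M = UNIV"
proof -
  have "subalgebra UNIV" by (simp add: subalgebra_def subspace_UNIV)
  from frattini_ideal_greatest[OF this] have "\<not> I \<subseteq> frattini_subalgebra UNIV"
    using I phi_free subspace_0[OF idealD(1)[OF I(1)]] by (auto simp: phi_free_def)
  then obtain M where M: "maximal_subalgebra UNIV M" "\<not> I \<subseteq> M"
    by (auto simp: frattini_subalgebra_def)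
  then have sub: "subalgebra M" by (simp add: maximal_subalgebra_def)
  have "I \<subseteq> sum_space I M" "M \<subseteq> sum_space I M"
    using idealD(1)[OF I(1)] sub by (simp_all add: subalgebra_def sum_space_upper1 sum_space_upper2)
  then have "sum_space I M = UNIV"
    using M subalgebra_ideal_sum[OF I(1) sub] unfolding maximal_subalgebra_def
    by (metis subset_UNIV)
  then show ?thesis using that M sub by (auto simp: maximal_subalgebra_def)
qed

text \<open>A supplement \<open>M\<close> of \<open>I\<close> is proper, so the series of its square
  reaches zero; modulo \<open>I\<close> it bounds the series of the square of the whole
  algebra.\<close>

lemma strongly_solvable_mod_ideal:
  assumes I: "ideal UNIV I" "I \<noteq> {0}"
  obtains n where "lower_central_series (set_prod UNIV UNIV) n \<subseteq> I"
proof -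
  from ideal_supplement[OF I] obtain M
    where M: "subalgebra M" "M \<noteq> UNIV" "sum_space I M = UNIV" by metis
  from M have "M \<subset> UNIV" by blast
  with M(1) obtain n where n: "lower_central_series (set_prod M M) n = {0}"
    using min_nss
    unfolding minimally_non_strongly_solvable_def strongly_solvable_def nilpotent_def by blast
  have "set_prod UNIV UNIV \<subseteq> sum_space I (set_prod M M)"
    using M(3) by (intro set_prod_sum_space I) auto
  from lower_central_series_sum_space[OF I(1) this, of n] show ?thesis
    by (intro that[of n]) (auto simp: n elim!: sum_spaceE)
qed

text \<open>Otherwise a late term of the series would lie in both ideals and be zero, making the
  algebra strongly solvable.\<close>

lemma nonzero_ideals_meet:
  assumes "ideal UNIV I" "I \<noteq> {0}" "ideal UNIV J" "J \<noteq> {0}"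
  shows "I \<inter> J \<noteq> {0}"
proof
  assume IJ: "I \<inter> J = {0}"
  let ?l = "lower_central_series (set_prod UNIV UNIV)"
  obtain m n where "?l m \<subseteq> I" "?l n \<subseteq> J"
    using strongly_solvable_mod_ideal assms by metis
  then have "?l (m + n) \<subseteq> I \<inter> J"
    using lower_central_series_subset_ideal[OF assms(1)]
      lower_central_series_subset_ideal[OF assms(3), of _ n m] by (simp add: add.commute)
  moreover have "subspace (?l (m + n))" by (cases "m + n") auto
  then have "0 \<in> ?l (m + n)" by (rule subspace_0)
  ultimately have "?l (m + n) = {0}" using IJ by auto
  then show False
    using min_nss by (auto simp: minimally_non_strongly_solvable_def strongly_solvable_def nilpotent_def)
qed

text \<open>A nonzero ideal of least dimension meets any other nonzero ideal in a nonzero ideal,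
  which for reasons of dimension is all of the former.\<close>

lemma least_nonzero_ideal:
  obtains A where "ideal UNIV A" "A \<noteq> {0}"
    "\<And>I. ideal UNIV I \<Longrightarrow> I \<noteq> {0} \<Longrightarrow> A \<subseteq> I"
proof -
  have "UNIV \<noteq> {0::'a}"
  proof
    assume *: "UNIV = {0::'a}"
    then have "set_prod UNIV UNIV = {0}" by (metis mult_zero_left set_prod_eq_0_iff singletonD)
    then have "lower_central_series (set_prod UNIV UNIV) 0 = {0}" by simp
    then show False using min_nss
      unfolding minimally_non_strongly_solvable_def strongly_solvable_def nilpotent_def by blast
  qed
  then have "ideal UNIV UNIV \<and> UNIV \<noteq> {0::'a}" by (simp add: ideal_def subspace_UNIV)
  from ex_has_least_nat[of "\<lambda>I. ideal UNIV I \<and> I \<noteq> {0}", OF this, of dim]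
  obtain A where A: "ideal UNIV A" "A \<noteq> {0}"
    and min: "\<And>I. ideal UNIV I \<Longrightarrow> I \<noteq> {0} \<Longrightarrow> dim A \<le> dim I" by metis
  have "A \<subseteq> I" if I: "ideal UNIV I" "I \<noteq> {0}" for I
  proof -
    have "ideal UNIV (A \<inter> I)" "A \<inter> I \<noteq> {0}"
      using A I nonzero_ideals_meet ideal_inter by auto
    then have "A \<inter> I = A"
      using min A by (intro subspace_dim_equal) (auto simp: ideal_def)
    then show ?thesis by blast
  qed
  with A show ?thesis using that by blast
qed

text \<open>The square of \<open>A\<close> is an ideal, so it is zero or contains \<open>A\<close>;
  solvability excludes the latter.\<close>

lemma least_ideal_abelian:
  assumes A: "ideal UNIV A" "A \<noteq> {0}" "\<And>I. ideal UNIV I \<Longrightarrow> I \<noteq> {0} \<Longrightarrow> A \<subseteq> I"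
  shows "set_prod A A = {0}"
proof (rule ccontr)
  assume "set_prod A A \<noteq> {0}"
  then have "A \<subseteq> set_prod A A" using A ideal_set_prod by blast
  then have "A \<subseteq> {0}" using solvable by (intro solvable_perfect_subset)
  then show False using A(2) subspace_0[OF idealD(1)[OF A(1)]] by auto
qed

end

section \<open>The complement \<open>H\<close> acting on the least ideal \<open>A\<close>\<close>

locale split_minimal_nss_algebra = minimal_nss_algebra scale mult Basis
  for scale :: "'k::field \<Rightarrow> 'a::ab_group_add \<Rightarrow> 'a" (infixr "*s" 75)
    and mult :: "'a \<Rightarrow> 'a \<Rightarrow> 'a" (infixl "\<cdot>" 70)
    and Basis :: "'a set" +
  fixes A H :: "'a set"
  assumes ideal_A: "ideal UNIV A"
    and A_nonzero: "A \<noteq> {0}"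
    and A_least: "ideal UNIV I \<Longrightarrow> I \<noteq> {0} \<Longrightarrow> A \<subseteq> I"
    and A_abelian: "set_prod A A = {0}"
    and subalgebra_H: "subalgebra H"
    and sum_AH: "sum_space A H = UNIV"
    and A_inter_H: "A \<inter> H = {0}"
begin

lemma subspace_A: "subspace A"
  and A_mult: "a \<in> A \<Longrightarrow> l \<cdot> a \<in> A" "a \<in> A \<Longrightarrow> a \<cdot> l \<in> A"
  using ideal_A by (auto simp: ideal_def)

lemma subspace_H: "subspace H"
  and H_mult: "x \<in> H \<Longrightarrow> y \<in> H \<Longrightarrow> x \<cdot> y \<in> H"
  using subalgebra_H by (auto simp: subalgebra_def)

lemma A_mult_A: "a \<in> A \<Longrightarrow> b \<in> A \<Longrightarrow> a \<cdot> b = 0"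
  using A_abelian by (simp add: set_prod_eq_0_iff)

lemma decompose:
  obtains a h where "l = a + h" "a \<in> A" "h \<in> H"
  using sum_AH sum_spaceE[of l A H] by blast

text \<open>\<open>Leib UNIV\<close> is an ideal, so it is zero or contains the least ideal
  \<open>A\<close>; \<open>Leib_mult\<close> does the rest.\<close>

lemma lie_or_A_annihilates: "lie UNIV \<or> A \<subseteq> Leib UNIV \<and> (\<forall>a\<in>A. \<forall>l. a \<cdot> l = 0)"
proof (cases "Leib UNIV = {0}")
  case True
  have "x \<cdot> x \<in> Leib UNIV" for x by (auto simp: Leib_def intro!: span_base)
  then show ?thesis using True by (auto simp: lie_def)
next
  case False
  then show ?thesis using A_least[OF ideal_Leib] Leib_mult by blast
qed

text \<open>Reduces products with a left factor from \<open>A\<close> to the left action on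
  \<open>A\<close>.\<close>

lemma right_action:
  assumes "a \<in> A"
  shows "a \<cdot> l = 0 \<or> a \<cdot> l = - (l \<cdot> a)"
  using lie_or_A_annihilates assms lie_antisym[of UNIV a l] subspace_UNIV by blast

text \<open>Irreducibility of the action: \<open>A\<close> annihilates itself and
  \<open>right_action\<close> handles products from the right, so an \<open>H\<close>-invariant
  subspace of \<open>A\<close> is an ideal of the whole algebra.\<close>

lemma submodule:
  assumes V: "subspace V" "V \<subseteq> A" "V \<noteq> {0}" and inv: "\<And>h v. h \<in> H \<Longrightarrow> v \<in> V \<Longrightarrow> h \<cdot> v \<in> V"
  shows "V = A"
proof -
  have left: "l \<cdot> v \<in> V" if "v \<in> V" for l v
  proof -
    obtain a h where "l = a + h" "a \<in> A" "h \<in> H" by (rule decompose)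
    then show ?thesis using that V(2) inv A_mult_A[of a v] by auto
  qed
  moreover have "v \<cdot> l \<in> V" if "v \<in> V" for l v
    using right_action[of v l] that V(2) left[of v l] subspace_0[OF V(1)] subspace_neg[OF V(1)]
    by (metis subsetD)
  ultimately have "ideal UNIV V" using V by (auto simp: ideal_def)
  then show ?thesis using A_least V by blast
qed

text \<open>The annihilator of \<open>A\<close> in \<open>H\<close> is an ideal of the whole
  algebra. If nonzero it would contain \<open>A\<close>, although \<open>H\<close> meets
  \<open>A\<close> trivially.\<close>

lemma faithful:
  assumes "h \<in> H" "\<And>a. a \<in> A \<Longrightarrow> h \<cdot> a = 0"
  shows "h = 0"
proof (rule ccontr)
  assume "h \<noteq> 0"
  define C where "C = {c \<in> H. \<forall>a\<in>A. c \<cdot> a = 0}"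
  have CA: "c \<cdot> a = 0 \<and> a \<cdot> c = 0" if "c \<in> C" "a \<in> A" for a c
    using that right_action[of a c] by (auto simp: C_def)
  have HC: "k \<cdot> c \<in> C \<and> c \<cdot> k \<in> C" if "c \<in> C" "k \<in> H" for c k
  proof -
    have "k \<cdot> c \<cdot> a = 0 \<and> c \<cdot> k \<cdot> a = 0" if "a \<in> A" for a
      using CA[OF \<open>c \<in> C\<close> that] CA[OF \<open>c \<in> C\<close> A_mult(1)[OF that], of k]
      by (simp add: leibniz_left[of k c a] leibniz_left[of c k a])
    then show ?thesis using that H_mult by (simp add: C_def)
  qed
  have "l \<cdot> c \<in> C \<and> c \<cdot> l \<in> C" if "c \<in> C" for l c
  proof -
    obtain a k where "l = a + k" "a \<in> A" "k \<in> H" by (rule decompose)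
    then show ?thesis using that HC CA by auto
  qed
  moreover have "subspace C" using subspace_H by (auto simp: C_def subspace_def)
  ultimately have "ideal UNIV C" by (simp add: ideal_def)
  moreover have "C \<noteq> {0}" using assms \<open>h \<noteq> 0\<close> by (auto simp: C_def)
  ultimately have "A \<subseteq> C" by (rule A_least)
  then have "A \<subseteq> A \<inter> H" by (auto simp: C_def)
  then show False using A_nonzero A_inter_H subspace_0[OF subspace_A] by auto
qed

text \<open>By \<open>leibniz_left\<close> a square acts as zero on \<open>A\<close>, so
  faithfulness applies.\<close>

lemma lie_H: "lie H"
  unfolding lie_def
proof
  fix x assume "x \<in> H"
  then show "x \<cdot> x = 0" 
    by (intro faithful[of "x \<cdot> x"] H_mult) (simp_all add: leibniz_left[of x x])
qed

lemma H_antisym: "x \<in> H \<Longrightarrow> y \<in> H \<Longrightarrow> x \<cdot> y = - (y \<cdot> x)"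
  using lie_antisym lie_H subspace_H by blast

lemma H_square: "x \<in> H \<Longrightarrow> x \<cdot> x = 0"
  using lie_H by (simp add: lie_def)

text \<open>If \<open>H\<close> were abelian, all products would lie in the abelian ideal
  \<open>A\<close>, and the algebra would be strongly solvable.\<close>

lemma H_nonabelian:
  "\<exists>x\<in>H. \<exists>y\<in>H. x \<cdot> y \<noteq> 0"
proof (rule ccontr)
  assume "\<not> ?thesis"
  then have H0: "x \<cdot> y = 0" if "x \<in> H" "y \<in> H" for x y using that by blast
  have "set_prod UNIV UNIV \<subseteq> A"
  proof (rule set_prod_least[OF subspace_A])
    fix u v :: 'a
    obtain a h where u: "u = a + h" "a \<in> A" "h \<in> H" by (rule decompose)
    obtain b k where v: "v = b + k" "b \<in> A" "k \<in> H" by (rule decompose)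
    show "u \<cdot> v \<in> A"
      using u v A_mult subspace_A by (simp add: H0 subspace_add)
  qed
  then have "lower_central_series (set_prod UNIV UNIV) 1 = {0}"
    using A_mult_A by (auto simp: set_prod_eq_0_iff subset_iff)
  then show False
    using min_nss
    unfolding minimally_non_strongly_solvable_def strongly_solvable_def nilpotent_def by blast
qed

text \<open>On a line all left multiplications are scalars and commute, so by faithfulness
  \<open>H\<close> would be abelian.\<close>

lemma dim_A: "dim A \<ge> 2"
proof (rule ccontr)
  assume "\<not> dim A \<ge> 2"
  obtain B where B: "B \<subseteq> A" "independent B" "A \<subseteq> span B" "card B = dim A" by (rule basis_exists)
  have "finite B" "B \<noteq> {}"
    using B A_nonzero subspace_0[OF subspace_A] by (auto intro: finiteI_independent)
  then have "card B = 1" using B(4) \<open>\<not> dim A \<ge> 2\<close> by (cases "card B") auto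
  then obtain b where b: "B = {b}" by (auto simp: card_1_singleton_iff)
  have span: "\<exists>c. a = c *s b" if "a \<in> A" for a
    using that B(3) by (auto simp: b span_singleton)
  have "b \<in> A" using B b by auto
  have "x \<cdot> y = 0" if xy: "x \<in> H" "y \<in> H" for x y
  proof (rule faithful)
    show "x \<cdot> y \<in> H" using xy by (rule H_mult)
    fix a assume a: "a \<in> A"
    obtain c d e where "a = c *s b" "x \<cdot> b = d *s b" "y \<cdot> b = e *s b"
      using span A_mult \<open>b \<in> A\<close> a by metis
    then show "x \<cdot> y \<cdot> a = 0" by (simp add: leibniz_left[of x y] mult.commute)
  qed
  then show False using H_nonabelian by blast
qed

text \<open>If J is nonzero then \<open>J \<cdot> A = A\<close>, so A survives in the whole lower central series
  of \<open>(A + K)\<^sup>2\<close>, although \<open>A + K\<close> is a proper subalgebra.\<close>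
lemma ideal_in_proper_square_zero:
  assumes K: "subalgebra K" "K \<subset> H" and J: "ideal H J" "J \<subseteq> set_prod K K"
  shows "J = {0}"
proof (rule ccontr)
  assume J0: "J \<noteq> {0}"
  let ?T = "sum_space A K"
  have subK: "subspace K" using K by (simp add: subalgebra_def)
  have T: "K \<subseteq> ?T" "A \<subseteq> ?T" using subK subspace_A by (simp_all add: sum_space_upper1 sum_space_upper2)
  \<comment> \<open>Since \<open>K\<close> lies in \<open>H\<close>, which meets \<open>A\<close>
    trivially, \<open>?T\<close> can be everything only if \<open>K\<close> is all of
    \<open>H\<close>.\<close>
  have "?T \<noteq> UNIV"
  proof
    assume T: "?T = UNIV"
    have "H \<subseteq> K"
    proof
      fix h assume h: "h \<in> H"
      from T obtain a k where ak: "h = a + k" "a \<in> A" "k \<in> K" using sum_spaceE[of h A K] by blast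
      then have "a = h - k" by simp
      moreover have "h - k \<in> H" using h ak K by (intro subspace_diff[OF subspace_H]) auto
      ultimately have "a \<in> A \<inter> H" using ak by simp
      then show "h \<in> K" using ak unfolding A_inter_H by simp
    qed
    then show False using K by blast
  qed
  then obtain n where n: "lower_central_series (set_prod ?T ?T) n = {0}"
    using min_nss subalgebra_ideal_sum[OF ideal_A K(1)]
    unfolding minimally_non_strongly_solvable_def strongly_solvable_def nilpotent_def by blast
  have subJ: "subspace J" and JH: "J \<subseteq> H" using J by (auto simp: ideal_def)
  obtain j where j: "j \<in> J" "j \<noteq> 0" using J0 subspace_0[OF subJ] by auto
  then obtain a where a: "a \<in> A" "j \<cdot> a \<noteq> 0" using faithful JH by blast
  \<comment> \<open>\<open>J\<close> is an ideal of \<open>H\<close>, so the Leibniz identity makes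
    this product \<open>H\<close>-invariant, and irreducibility applies.\<close>
  have "set_prod J A = A"
  proof (rule submodule)
    show "set_prod J A \<subseteq> A" using A_mult subspace_A by (intro set_prod_least) auto
    show "set_prod J A \<noteq> {0}" using j a by (auto simp: set_prod_eq_0_iff)
    fix h v assume h: "h \<in> H" and v: "v \<in> set_prod J A"
    have "set_prod J A \<subseteq> {v. h \<cdot> v \<in> set_prod J A}"
    proof (rule set_prod_least)
      fix j a assume "j \<in> J" "a \<in> A"
      then show "j \<cdot> a \<in> {v. h \<cdot> v \<in> set_prod J A}"
        using h idealD(3)[OF J(1) h] A_mult
        by (auto simp: leibniz[of h j a] intro!: subspace_add[OF subspace_set_prod] set_prodI)
    qed (simp add: subspace_left_preimage)
    then show "h \<cdot> v \<in> set_prod J A" using v by blast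
  qed simp
  moreover have JT: "J \<subseteq> set_prod ?T ?T" using J(2) set_prod_mono[OF T(1) T(1)] by simp
  ultimately have step: "A \<subseteq> set_prod (set_prod ?T ?T) V" if "A \<subseteq> V" for V
    using set_prod_mono[OF JT that] by simp
  have "A \<subseteq> lower_central_series (set_prod ?T ?T) m" for m
  proof (induction m)
    \<comment> \<open>The series starts at the square of \<open>?T\<close>, so even the base case
      rests on \<open>set_prod J A = A\<close>.\<close>
    case 0
    have "set_prod K K \<subseteq> K" using K(1) by (intro set_prod_least) (auto simp: subalgebra_def)
    then have "set_prod J A \<subseteq> set_prod ?T ?T" using J(2) T by (intro set_prod_mono) auto
    then show ?case using \<open>set_prod J A = A\<close> by simp
  qed (simp add: step)
  from this[of n] show False using n A_nonzero subspace_0[OF subspace_A] by auto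
qed

section \<open>Abelian ideals of \<open>H\<close> and a hyperplane ideal\<close>

lemma proper_ideal_abelian:
  assumes "ideal H N" "N \<noteq> H" "u \<in> N" "v \<in> N"
  shows "u \<cdot> v = 0"
proof -
  \<comment> \<open>Here \<open>K\<close> is \<open>N\<close> itself and \<open>J\<close> is its
    square.\<close>
  have "set_prod N N = {0}"
    using assms(1,2) ideal_set_prod[OF assms(1)]
    by (intro ideal_in_proper_square_zero[of N]) (auto simp: subalgebra_def ideal_def)
  then show ?thesis using assms by (simp add: set_prod_eq_0_iff)
qed

text \<open>A subspace of \<open>H\<close> containing the square of \<open>H\<close> is an ideal,
  and solvability makes that square proper. A basis of it is extended to one of \<open>H\<close>,
  and one new vector is left out.\<close>

lemma ideal_hyperplane:
  obtains N x where "ideal H N" "x \<in> H" "x \<notin> N" "H = sum_space N (span {x})"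
proof -
  have HH: "set_prod H H \<subseteq> H" using subspace_H H_mult by (intro set_prod_least)
  have "\<not> H \<subseteq> set_prod H H"
  proof
    assume "H \<subseteq> set_prod H H"
    then have "H \<subseteq> {0}" using solvable by (intro solvable_perfect_subset)
    then show False using H_nonabelian by (metis mult_zero_left singletonD subsetD)
  qed
  obtain B where B: "B \<subseteq> set_prod H H" "independent B" "set_prod H H \<subseteq> span B"
    by (rule maximal_independent_subset)
  then have "B \<subseteq> H" using HH by simp
  then obtain B' where B': "B \<subseteq> B'" "B' \<subseteq> H" "independent B'" "H \<subseteq> span B'"
    using B(2) by (rule maximal_independent_subset_extend)
  have "span B \<subseteq> set_prod H H" using B(1) by (intro span_minimal) auto
  then have "B \<noteq> B'" using B'(4) \<open>\<not> H \<subseteq> set_prod H H\<close> by auto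
  then obtain x where x: "x \<in> B'" "x \<notin> B" using B' by blast
  define N where "N = span (B' - {x})"
  have NH: "N \<subseteq> H" unfolding N_def using B'(2) subspace_H by (intro span_minimal) auto
  have "set_prod H H \<subseteq> N"
    using B(3) span_mono[of B "B' - {x}"] x B' by (auto simp: N_def)
  then have "ideal H N"
    using NH set_prodI[of _ H _ H] by (auto simp: ideal_def N_def[symmetric] subset_iff) (simp add: N_def)
  moreover have "x \<notin> N" using B'(3) x by (auto simp: N_def dependent_def)
  moreover have "span B' = sum_space N (span {x})"
    using x span_Un[of "B' - {x}" "{x}"] by (simp add: sum_space_def N_def insert_absorb)
  then have "H = sum_space N (span {x})"
    using B' span_minimal[OF B'(2) subspace_H] by auto
  ultimately show ?thesis using that x B' by blast
qed

end

section \<open>The structure of \<open>H\<close>\<close>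

locale hyperplane_split_algebra = split_minimal_nss_algebra scale mult Basis A H
  for scale :: "'k::field \<Rightarrow> 'a::ab_group_add \<Rightarrow> 'a" (infixr "*s" 75)
    and mult :: "'a \<Rightarrow> 'a \<Rightarrow> 'a" (infixl "\<cdot>" 70)
    and Basis A H :: "'a set" +
  fixes N :: "'a set" and x :: 'a
  assumes ideal_N: "ideal H N"
    and x_H: "x \<in> H"
    and x_notin_N: "x \<notin> N"
    and sum_Nx: "H = sum_space N (span {x})"
begin

lemma subspace_N: "subspace N"
  and N_subset_H: "N \<subseteq> H"
  and xN: "n \<in> N \<Longrightarrow> x \<cdot> n \<in> N"
  using ideal_N x_H by (auto simp: ideal_def)

lemma H_decompose:
  assumes "h \<in> H"
  obtains n c where "h = n + c *s x" "n \<in> N"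
  using assms sum_Nx by (auto simp: span_singleton elim!: sum_spaceE)

lemma N_mult_N: "u \<in> N \<Longrightarrow> v \<in> N \<Longrightarrow> u \<cdot> v = 0"
  using proper_ideal_abelian[OF ideal_N] x_H x_notin_N by blast

lemma N_actions_commute: "u \<in> N \<Longrightarrow> v \<in> N \<Longrightarrow> u \<cdot> (v \<cdot> a) = v \<cdot> (u \<cdot> a)"
  by (simp add: leibniz[of u v a] N_mult_N)

lemma N_mult_x: "n \<in> N \<Longrightarrow> n \<cdot> x = - (x \<cdot> n)"
  using H_antisym N_subset_H x_H by blast

text \<open>\<open>N\<close> is abelian, \<open>H\<close> is antisymmetric and consists of
  \<open>N\<close> plus multiples of \<open>x\<close>, so only left multiplication by
  \<open>x\<close> matters.\<close>

lemma ideal_H_iff: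
  assumes "J \<subseteq> N"
  shows "ideal H J \<longleftrightarrow> subspace J \<and> (\<forall>j\<in>J. x \<cdot> j \<in> J)"
proof
  assume "ideal H J"
  then show "subspace J \<and> (\<forall>j\<in>J. x \<cdot> j \<in> J)" using x_H by (auto simp: ideal_def)
next
  assume J: "subspace J \<and> (\<forall>j\<in>J. x \<cdot> j \<in> J)"
  have left: "h \<cdot> j \<in> J" if j: "j \<in> J" and h: "h \<in> H" for h j
  proof -
    obtain n c where "h = n + c *s x" "n \<in> N" using h by (rule H_decompose)
    then show ?thesis using J j assms N_mult_N[of n j] by (auto simp: subspace_scale)
  qed
  have "j \<cdot> h \<in> J" if j: "j \<in> J" and h: "h \<in> H" for h j
  proof -
    have "j \<cdot> h = - (h \<cdot> j)" using assms N_subset_H j h by (intro H_antisym) auto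
    then show ?thesis using left[OF j h] J by (simp add: subspace_neg)
  qed
  then show "ideal H J" using left J assms N_subset_H by (auto simp: ideal_def)
qed

lemma x_mult_nonzero: "\<exists>n\<in>N. x \<cdot> n \<noteq> 0"
proof (rule ccontr)
  assume "\<not> ?thesis"
  then have x0: "x \<cdot> n = 0" if "n \<in> N" for n using that by blast
  obtain u v where uv: "u \<in> H" "v \<in> H" "u \<cdot> v \<noteq> 0" using H_nonabelian by blast
  obtain n c where u: "u = n + c *s x" "n \<in> N" using uv(1) by (rule H_decompose)
  obtain m d where v: "v = m + d *s x" "m \<in> N" using uv(2) by (rule H_decompose)
  have "u \<cdot> v = 0"
    using u(2) v(2) by (simp add: u(1) v(1) N_mult_N N_mult_x x0 H_square[OF x_H])
  then show False using uv(3) by simp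
qed

text \<open>The sum of \<open>J\<close> and the line of \<open>x\<close> is a proper subalgebra of
  \<open>H\<close> whose square contains the image of \<open>J\<close> under \<open>x\<close>. That
  image is an ideal of \<open>H\<close>, so \<open>ideal_in_proper_square_zero\<close>
  applies.\<close>

lemma proper_invariant_killed:
  assumes J: "subspace J" "J \<subseteq> N" "J \<noteq> N" "\<And>j. j \<in> J \<Longrightarrow> x \<cdot> j \<in> J" and m: "m \<in> J"
  shows "x \<cdot> m = 0"
proof -
  let ?K = "sum_space J (span {x})" and ?R = "(\<cdot>) x ` J"
  have subK: "subspace ?K" using J by (intro subspace_sum_space) auto
  have xx: "x \<cdot> x = 0" using x_H by (rule H_square)
  have "subalgebra ?K"
    unfolding subalgebra_def
  proof (intro conjI ballI subK)
    fix u v assume u: "u \<in> ?K" and v: "v \<in> ?K"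
    obtain i c where i: "u = i + c *s x" "i \<in> J" using u by (auto simp: span_singleton elim!: sum_spaceE)
    obtain j d where j: "v = j + d *s x" "j \<in> J" using v by (auto simp: span_singleton elim!: sum_spaceE)
    have "i \<in> N" "j \<in> N" using i j J by auto
    have "u \<cdot> v = c *s (x \<cdot> j) - d *s (x \<cdot> i)"
      using \<open>i \<in> N\<close> \<open>j \<in> N\<close> by (simp add: i(1) j(1) N_mult_N N_mult_x xx)
    also have "\<dots> \<in> J"
      by (intro subspace_diff subspace_scale J(1) J(4)[OF i(2)] J(4)[OF j(2)])
    finally have "u \<cdot> v \<in> J" .
    then show "u \<cdot> v \<in> ?K" using sum_space_upper1[of "span {x}" J] by auto
  qed
  moreover have "?K \<subset> H"
  proof -
    \<comment> \<open>An element of \<open>N\<close> outside \<open>J\<close> is also outside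
      \<open>?K\<close>: otherwise a nonzero multiple of \<open>x\<close> would fall into
      \<open>N\<close>.\<close>
    obtain n where n: "n \<in> N" "n \<notin> J" using J by auto
    have "n \<notin> ?K"
    proof
      assume "n \<in> ?K"
      then obtain j c where j: "n = j + c *s x" "j \<in> J" by (auto simp: span_singleton elim!: sum_spaceE)
      show False
      proof (cases "c = 0")
        case False
        have "c *s x = n - j" using j by simp
        also have "\<dots> \<in> N" using n j(2) J(2) by (intro subspace_diff subspace_N) auto
        finally have "c *s x \<in> N" .
        then have "inverse c *s (c *s x) \<in> N" using subspace_N by (rule subspace_scale[rotated])
        then show False using False x_notin_N by simp
      qed (use j n in simp)
    qed
    moreover have "?K \<subseteq> H" using J by (subst sum_Nx) (auto simp: sum_space_def)
    ultimately show ?thesis using n N_subset_H by auto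
  qed
  moreover have "ideal H ?R"
  proof (subst ideal_H_iff)
    have "subspace ?R"
      using module_hom.subspace_image[OF Vector_Spaces.linear.axioms(3)[OF linear_mult_right] J(1)] .
    then show "subspace ?R \<and> (\<forall>j\<in>?R. x \<cdot> j \<in> ?R)" using J(4) by auto
  qed (use J xN in auto)
  moreover have "?R \<subseteq> set_prod ?K ?K"
  proof
    fix r assume "r \<in> ?R"
    then obtain j where "j \<in> J" "r = x \<cdot> j" by auto
    moreover have "x \<in> ?K" using sum_space_upper2[OF J(1), of "span {x}"] span_base[of x "{x}"] by auto
    moreover have "j \<in> ?K" using sum_space_upper1[of "span {x}" J] \<open>j \<in> J\<close> by auto
    ultimately show "r \<in> set_prod ?K ?K" by (simp add: set_prodI)
  qed
  ultimately have "?R = {0}" by (rule ideal_in_proper_square_zero)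
  then show ?thesis using m by blast
qed

text \<open>If \<open>x\<close> maps \<open>N\<close> onto itself, it is injective there, so the
  proper invariant subspaces, being killed, are zero. Otherwise the image of \<open>N\<close> is a
  proper invariant subspace, so \<open>x\<close> squares to zero on \<open>N\<close>, and a vector
  not killed by \<open>x\<close> spans \<open>N\<close> together with its image.\<close>

lemma structure_H:
  "(\<exists>M y. y \<in> H \<and> direct_sum H M (span {y}) \<and> minimal_ideal H M \<and> set_prod M M = {0})
    \<or> heisenberg H"
proof (cases "(\<cdot>) x ` N = N")
  case True
  \<comment> \<open>Dimension count: a nonzero kernel vector extends to a basis of \<open>N\<close>,
    and the images of the other basis vectors would already span \<open>N\<close>.\<close>
  have inj: "m = 0" if m: "m \<in> N" "x \<cdot> m = 0" for m
  proof (rule ccontr)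
    assume "m \<noteq> 0"
    then have "independent {m}" "{m} \<subseteq> N" using m by (auto simp: dependent_single)
    then obtain B where B: "{m} \<subseteq> B" "B \<subseteq> N" "independent B" "N \<subseteq> span B"
      by (metis maximal_independent_subset_extend)
    have fin: "finite B" using B(3) by (rule finiteI_independent)
    have "B \<subseteq> {n. x \<cdot> n \<in> span ((\<cdot>) x ` (B - {m}))}"
    proof
      fix b assume "b \<in> B"
      then show "b \<in> {n. x \<cdot> n \<in> span ((\<cdot>) x ` (B - {m}))}"
        using m(2) by (cases "b = m") (auto intro: span_base simp: span_zero)
    qed
    then have "span B \<subseteq> {n. x \<cdot> n \<in> span ((\<cdot>) x ` (B - {m}))}"
      by (intro span_minimal subspace_left_preimage subspace_span)
    then have "N \<subseteq> span ((\<cdot>) x ` (B - {m}))"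
      using B(4) by (subst True[symmetric]) auto
    then have "dim N \<le> card ((\<cdot>) x ` (B - {m}))" using fin by (intro dim_le_card) auto
    also have "\<dots> \<le> card (B - {m})" using fin by (intro card_image_le) auto
    also have "\<dots> < card B" using fin B(1) by (intro psubset_card_mono) auto
    also have "card B \<le> dim N" using B by (intro independent_card_le_dim)
    finally show False by simp
  qed
  have "minimal_ideal H N"
    unfolding minimal_ideal_def
  proof (intro conjI allI impI ideal_N)
    show "N \<noteq> {0}" using x_mult_nonzero by auto
    fix J assume J: "ideal H J \<and> J \<subseteq> N"
    show "J = {0} \<or> J = N"
    proof (rule ccontr)
      assume *: "\<not> (J = {0} \<or> J = N)"
      have J': "subspace J" "\<And>j. j \<in> J \<Longrightarrow> x \<cdot> j \<in> J" using J ideal_H_iff by auto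
      have "m = 0" if "m \<in> J" for m
        using inj[of m] proper_invariant_killed[of J m] J J' that * by blast
      then show False using * subspace_0[OF J'(1)] by blast
    qed
  qed
  moreover have "N \<inter> span {x} = {0}"
  proof -
    have "c *s x = 0" if "c *s x \<in> N" for c
      using subspace_scale[OF subspace_N that, of "inverse c"] x_notin_N by (cases "c = 0") auto
    then show ?thesis using subspace_0[OF subspace_N] by (auto simp: span_singleton intro: span_zero)
  qed
  then have "direct_sum H N (span {x})"
    using subspace_N sum_Nx by (simp add: direct_sum_def sum_space_def)
  ultimately show ?thesis using x_H N_mult_N by (auto simp: set_prod_eq_0_iff)
next
  case False
  have "subspace ((\<cdot>) x ` N)"
    using module_hom.subspace_image[OF Vector_Spaces.linear.axioms(3)[OF linear_mult_right] subspace_N] .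
  then have xx0: "x \<cdot> (x \<cdot> n) = 0" if "n \<in> N" for n
    using proper_invariant_killed[of "(\<cdot>) x ` N" "x \<cdot> n"] False that xN by blast
  obtain n where n: "n \<in> N" "x \<cdot> n \<noteq> 0" using x_mult_nonzero by blast
  define z where "z = x \<cdot> n"
  have z: "z \<in> N" "z \<noteq> 0" "x \<cdot> z = 0" "x \<cdot> n = z" using n xN xx0 by (auto simp: z_def)
  have "span {n, z} = N"
  proof (rule ccontr)
    assume *: "span {n, z} \<noteq> N"
    have "{n, z} \<subseteq> {m. x \<cdot> m \<in> span {n, z}}"
      using z by (auto intro: span_base span_zero)
    then have "span {n, z} \<subseteq> {m. x \<cdot> m \<in> span {n, z}}"
      by (intro span_minimal subspace_left_preimage subspace_span)
    moreover have "span {n, z} \<subseteq> N" using n z subspace_N by (intro span_minimal) auto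
    ultimately have "x \<cdot> n = 0"
      using * by (intro proper_invariant_killed[of "span {n, z}"]) (auto intro: span_base)
    then show False using n by simp
  qed
  \<comment> \<open>The roles of \<open>x\<close>, \<open>y\<close>, \<open>z\<close> in
    \<open>heisenberg\<close> are played by \<open>n\<close>, \<open>x\<close>,
    \<open>z\<close>.\<close>
  then have H: "span {n, x, z} = H"
    using sum_Nx span_Un[of "{n, z}" "{x}"] by (simp add: sum_space_def insert_commute)
  have nz: "n \<notin> span {z}"
  proof
    assume "n \<in> span {z}"
    then obtain k where "n = k *s z" by (auto simp: span_singleton)
    then have "x \<cdot> n = k *s (x \<cdot> z)" by simp
    then show False using z(3) n(2) by simp
  qed
  then have indep: "independent {n, z}"
    using z by (auto simp: independent_insert dependent_single)
  moreover have "x \<notin> span {n, z}" using x_notin_N \<open>span {n, z} = N\<close> by simp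
  ultimately have "independent {n, x, z}"
    using independent_insertI[of x "{n, z}"] by (simp add: insert_commute)
  moreover have "distinct [n, x, z]"
    using nz n z x_notin_N span_base[of n "{z}"] by auto
  moreover have "z \<cdot> h = 0 \<and> h \<cdot> z = 0" if hH: "h \<in> H" for h
  proof -
    obtain m c where h: "h = m + c *s x" "m \<in> N" using hH by (rule H_decompose)
    then show ?thesis using z by (simp add: N_mult_N N_mult_x)
  qed
  moreover have "n \<cdot> x = - z" using N_mult_x n z by simp
  ultimately have "heisenberg H"
    unfolding heisenberg_def using subalgebra_H lie_H H z(4) by blast
  then show ?thesis by blast
qed

section \<open>Positive characteristic\<close>

lemma locally_nilpotent_or_injective:
  assumes y: "y \<in> N"
  shows "(\<forall>a\<in>A. \<exists>k. ((\<cdot>) y ^^ k) a = 0) \<or> (\<forall>a\<in>A. y \<cdot> a = 0 \<longrightarrow> a = 0)"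
proof -
  \<comment> \<open>The generalised kernel of \<open>y\<close> on \<open>A\<close>; being
    \<open>H\<close>-invariant, it is zero or all of \<open>A\<close>.\<close>
  define V where "V = {a \<in> A. \<exists>k. ((\<cdot>) y ^^ k) a = 0}"
  have "subspace V"
  proof (unfold subspace_def, intro conjI ballI allI)
    show "0 \<in> V" using subspace_0[OF subspace_A] mult_power_zero by (auto simp: V_def)
  next
    fix a b assume ab: "a \<in> V" "b \<in> V"
    then obtain k l where "((\<cdot>) y ^^ k) a = 0" "((\<cdot>) y ^^ l) b = 0" by (auto simp: V_def)
    then have "((\<cdot>) y ^^ (k + l)) (a + b) = 0"
      using mult_power_eq_0_mono[of k y a l] mult_power_eq_0_mono[of l y b k]
      by (simp add: mult_power_add add.commute)
    then show "a + b \<in> V" using ab subspace_A by (auto simp: V_def subspace_add)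
  next
    fix c a assume "a \<in> V"
    then show "c *s a \<in> V"
      using subspace_A by (auto simp: V_def subspace_scale mult_power_scale)
  qed
  moreover have "h \<cdot> a \<in> V" if h: "h \<in> H" and a: "a \<in> V" for h a
  proof -
    have N: "((\<cdot>) y ^^ k) (m \<cdot> a) = m \<cdot> ((\<cdot>) y ^^ k) a" if "m \<in> N" for m k a
      by (induction k) (simp_all add: N_actions_commute[OF y that])
    \<comment> \<open>Moving \<open>y\<close> past \<open>x\<close> produces the factor
      \<open>x \<cdot> y\<close> in \<open>N\<close>, which commutes with \<open>y\<close>; so
      applying \<open>x\<close> raises the exponent by at most one.\<close>
    have X: "((\<cdot>) y ^^ k) a = 0 \<Longrightarrow> ((\<cdot>) y ^^ Suc k) (x \<cdot> a) = 0" for k a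
    proof (induction k arbitrary: a)
      case (Suc k)
      then have "((\<cdot>) y ^^ Suc k) (x \<cdot> (y \<cdot> a)) = 0" by (simp add: funpow_swap1)
      moreover have "((\<cdot>) y ^^ Suc k) ((x \<cdot> y) \<cdot> a) = 0"
        using N[OF xN[OF y], of "Suc k" a] Suc.prems by simp
      moreover have "x \<cdot> (y \<cdot> a) = (x \<cdot> y) \<cdot> a + y \<cdot> (x \<cdot> a)" by (rule leibniz)
      ultimately have "((\<cdot>) y ^^ Suc k) (y \<cdot> (x \<cdot> a)) = 0" by (simp only: mult_power_add) simp
      then show ?case by (simp add: funpow_swap1)
    qed simp
    obtain m c where m: "h = m + c *s x" "m \<in> N" using h by (rule H_decompose)
    obtain k where k: "((\<cdot>) y ^^ k) a = 0" using a by (auto simp: V_def)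
    have "((\<cdot>) y ^^ Suc k) (h \<cdot> a) = 0"
      using N[OF m(2), of "Suc k" a] X[OF k] k by (simp add: m(1) mult_power_add mult_power_scale)
    then show ?thesis using a A_mult unfolding V_def by blast
  qed
  moreover have "V \<subseteq> A" by (auto simp: V_def)
  ultimately have "V = {0} \<or> V = A" using submodule by blast
  then show ?thesis
  proof
    assume V: "V = {0}"
    have "a = 0" if "a \<in> A" "y \<cdot> a = 0" for a
    proof -
      have "((\<cdot>) y ^^ 1) a = 0" using that by simp
      then have "a \<in> V" using that unfolding V_def by blast
      then show ?thesis using V by simp
    qed
    then show ?thesis by blast
  qed (auto simp: V_def)
qed

lemma poly_act_commute:
  assumes "n \<in> N" "y \<in> N"
  shows "y \<cdot> poly_act n p a = poly_act n p (y \<cdot> a)"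
  by (induction p) (use assms in \<open>simp_all add: N_actions_commute[of y n]\<close>)

text \<open>Left multiplication by \<open>x\<close> is a derivation and \<open>x \<cdot> n\<close>
  commutes with \<open>n\<close>, so the commutator of \<open>x\<close> with \<open>p(n)\<close> is
  \<open>p'(n)\<close> times \<open>x \<cdot> n\<close>.\<close>

lemma x_mult_poly_act:
  assumes n: "n \<in> N"
  shows "x \<cdot> poly_act n p a = poly_act n p (x \<cdot> a) + poly_act n (pderiv p) ((x \<cdot> n) \<cdot> a)"
proof (induction p)
  case (pCons c p)
  have "x \<cdot> (n \<cdot> poly_act n p a) = (x \<cdot> n) \<cdot> poly_act n p a + n \<cdot> (x \<cdot> poly_act n p a)"
    by (rule leibniz)
  also have "(x \<cdot> n) \<cdot> poly_act n p a = poly_act n p ((x \<cdot> n) \<cdot> a)"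
    by (rule poly_act_commute[OF n xN[OF n]])
  finally show ?case
    by (simp add: pCons.IH pderiv_pCons poly_act_add add_ac)
qed simp

text \<open>For a nonzero \<open>p\<close> of least degree with \<open>p(n) = 0\<close> on
  \<open>A\<close>, injectivity would give \<open>p'(n) = 0\<close> on \<open>A\<close>; in
  characteristic 0, \<open>p'\<close> is nonzero and of smaller degree.\<close>

lemma not_injective:
  assumes char: "CHAR('k) = 0" and n: "n \<in> N"
  shows "\<not> (\<forall>a\<in>A. (x \<cdot> n) \<cdot> a = 0 \<longrightarrow> a = 0)"
proof
  assume inj: "\<forall>a\<in>A. (x \<cdot> n) \<cdot> a = 0 \<longrightarrow> a = 0"
  let ?P = "\<lambda>p. p \<noteq> 0 \<and> (\<forall>a\<in>A. poly_act n p a = 0)"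
  obtain p0 where "?P p0" using annihilating_poly by blast
  then obtain p where p: "?P p" and min: "\<And>q. ?P q \<Longrightarrow> degree p \<le> degree q"
    using ex_has_least_nat[of ?P p0 degree] by blast
  have der: "poly_act n (pderiv p) a = 0" if a: "a \<in> A" for a
  proof -
    have "poly_act n (pderiv p) ((x \<cdot> n) \<cdot> a) = 0"
      using x_mult_poly_act[OF n, of p a] p a A_mult by simp
    then have "(x \<cdot> n) \<cdot> poly_act n (pderiv p) a = 0"
      by (simp add: poly_act_commute[OF n xN[OF n]])
    moreover have "poly_act n (pderiv p) a \<in> A"
      using subspace_A A_mult a by (intro poly_act_closed) auto
    ultimately show ?thesis using inj by blast
  qed
  show False
  proof (cases "degree p")
    case 0
    then obtain c where c: "p = [:c:]" by (rule degree_eq_zeroE)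
    obtain a where "a \<in> A" "a \<noteq> 0" using A_nonzero subspace_0[OF subspace_A] by blast
    then show False using p c by auto
  next
    case (Suc d)
    have "of_nat (Suc d) \<noteq> (0::'k)" using char by (simp only: of_nat_eq_0_iff_char_dvd) simp
    then have "coeff (pderiv p) d \<noteq> 0" using Suc p leading_coeff_neq_0[of p] by (simp only: coeff_pderiv) simp
    then have "pderiv p \<noteq> 0" by auto
    then have "degree p \<le> degree (pderiv p)" using der by (intro min) auto
    also have "\<dots> \<le> d" using Suc by (intro degree_le) (simp add: coeff_pderiv coeff_eq_0)
    finally show False using Suc by simp
  qed
qed

text \<open>The maps commute, so iterating \<open>b\<close> on a vector killed by \<open>B\<close>
  keeps it killed by \<open>B\<close>; the last nonzero iterate is killed by \<open>b\<close>
  too.\<close>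

lemma common_kernel:
  assumes "finite B" "B \<subseteq> N" "\<And>b a. b \<in> B \<Longrightarrow> a \<in> A \<Longrightarrow> \<exists>k. ((\<cdot>) b ^^ k) a = 0"
  shows "\<exists>v\<in>A. v \<noteq> 0 \<and> (\<forall>b\<in>B. b \<cdot> v = 0)"
  using assms
proof (induction B)
  case empty
  then show ?case using A_nonzero subspace_0[OF subspace_A] by blast
next
  case (insert b B)
  then obtain v where v: "v \<in> A" "v \<noteq> 0" "\<forall>b\<in>B. b \<cdot> v = 0" by auto
  have "\<exists>k. ((\<cdot>) b ^^ k) v = 0" using insert.prems(2) v(1) by blast
  then obtain k where k: "((\<cdot>) b ^^ k) v = 0" "\<And>j. j < k \<Longrightarrow> ((\<cdot>) b ^^ j) v \<noteq> 0"
    using exists_least_iff[of "\<lambda>k. ((\<cdot>) b ^^ k) v = 0"] by blast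
  \<comment> \<open>The least \<open>k\<close> is positive because \<open>v\<close> is
    nonzero.\<close>
  then obtain j where j: "k = Suc j" using v(2) by (cases k) auto
  define w where "w = ((\<cdot>) b ^^ j) v"
  have "b' \<cdot> ((\<cdot>) b ^^ i) v = 0" if "b' \<in> B" for b' i
    using that v insert.prems(1) N_actions_commute[of b' b] by (induction i) auto
  moreover have "b \<cdot> w = 0" using k(1) j by (simp add: w_def)
  moreover have "w \<noteq> 0" using k(2) j by (simp add: w_def)
  moreover have "((\<cdot>) b ^^ i) v \<in> A" for i using v A_mult by (induction i) auto
  ultimately show ?case by (auto simp: w_def intro!: bexI[of _ w])
qed

lemma char_positive: "CHAR('k) > 0"
proof (rule ccontr)
  assume "\<not> CHAR('k) > 0"
  then have char: "CHAR('k) = 0" by simp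
  \<comment> \<open>The basis is chosen inside the image of \<open>N\<close> itself, so that each
    member has the form \<open>x \<cdot> n\<close> required by \<open>not_injective\<close>.\<close>
  obtain B where B: "B \<subseteq> (\<cdot>) x ` N" "independent B" "(\<cdot>) x ` N \<subseteq> span B"
    by (rule maximal_independent_subset)
  have BN: "B \<subseteq> N" using B(1) xN by auto
  have "\<exists>k. ((\<cdot>) b ^^ k) a = 0" if "b \<in> B" "a \<in> A" for b a
    using that B(1) BN locally_nilpotent_or_injective[of b] not_injective[OF char] by blast
  then obtain v where v: "v \<in> A" "v \<noteq> 0" "\<forall>b\<in>B. b \<cdot> v = 0"
    using common_kernel[OF finiteI_independent[OF B(2)] BN] by blast
  \<comment> \<open>This annihilator contains \<open>v\<close> and is a submodule, hence equals
    \<open>A\<close>; faithfulness then gives \<open>x \<cdot> n = 0\<close> for all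
    \<open>n\<close> in \<open>N\<close>.\<close>
  define V where "V = {a \<in> A. \<forall>n\<in>N. (x \<cdot> n) \<cdot> a = 0}"
  have "span B \<subseteq> {w. w \<cdot> v \<in> {0}}"
    using v by (intro span_minimal subspace_right_preimage) auto
  then have "v \<in> V" using B(3) v(1) by (auto simp: V_def)
  have "V = A"
  proof (rule submodule)
    show "subspace V" using subspace_A by (auto simp: V_def subspace_def)
    show "V \<subseteq> A" by (auto simp: V_def)
    show "V \<noteq> {0}" using \<open>v \<in> V\<close> v(2) by auto
    fix h a assume h: "h \<in> H" and a: "a \<in> V"
    obtain m c where m: "h = m + c *s x" "m \<in> N" using h by (rule H_decompose)
    have "(x \<cdot> n) \<cdot> (h \<cdot> a) = 0" if n: "n \<in> N" for n
    proof -
      have "(x \<cdot> n) \<cdot> (m \<cdot> a) = 0"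
        using N_actions_commute[OF xN[OF n] m(2)] a n by (simp add: V_def)
      \<comment> \<open>As \<open>x \<cdot> n\<close> lies in \<open>N\<close>, the element
        \<open>x \<cdot> (x \<cdot> n)\<close> kills \<open>a\<close> as well.\<close>
      moreover have "x \<cdot> ((x \<cdot> n) \<cdot> a) = (x \<cdot> (x \<cdot> n)) \<cdot> a + (x \<cdot> n) \<cdot> (x \<cdot> a)"
        by (rule leibniz)
      then have "(x \<cdot> n) \<cdot> (x \<cdot> a) = 0" using a n xN by (simp add: V_def)
      ultimately show ?thesis by (simp add: m(1))
    qed
    then show "h \<cdot> a \<in> V" using a A_mult by (simp add: V_def)
  qed
  have "x \<cdot> n = 0" if "n \<in> N" for n
  proof (rule faithful)
    show "x \<cdot> n \<in> H" using xN[OF that] N_subset_H by auto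
    show "(x \<cdot> n) \<cdot> a = 0" if "a \<in> A" for a
      using that \<open>V = A\<close> \<open>n \<in> N\<close> by (auto simp: V_def)
  qed
  then show False using x_mult_nonzero by blast
qed

end

section \<open>Existence of the splitting and assembly of the claims\<close>

context split_minimal_nss_algebra
begin

lemma char_positive_and_structure:
  "CHAR('k) > 0 \<and>
   ((\<exists>M y. y \<in> H \<and> direct_sum H M (span {y}) \<and> minimal_ideal H M \<and> set_prod M M = {0})
    \<or> heisenberg H)"
proof -
  obtain N x where "ideal H N" "x \<in> H" "x \<notin> N" "H = sum_space N (span {x})"
    by (rule ideal_hyperplane)
  then interpret hyperplane_split_algebra scale mult Basis A H N x
    by unfold_locales
  show ?thesis using char_positive structure_H by blast
qed

lemma lie_or_Leib:
  "lie UNIV \<or> \<not> lie UNIV \<and> lie H \<and> A = Leib UNIV \<and> set_prod A UNIV = {0}"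
proof (cases "lie UNIV")
  case False
  then have A: "A \<subseteq> Leib UNIV" "\<And>a l. a \<in> A \<Longrightarrow> a \<cdot> l = 0"
    using lie_or_A_annihilates by auto
  \<comment> \<open>The square of \<open>a + h\<close> reduces to \<open>h \<cdot> a\<close>:
    products with \<open>a\<close> on the left vanish, and \<open>H\<close> is Lie.\<close>
  have "l \<cdot> l \<in> A" for l
  proof -
    obtain a h where "l = a + h" "a \<in> A" "h \<in> H" by (rule decompose)
    then show ?thesis using A(2) A_mult H_square by simp
  qed
  then have "Leib UNIV \<subseteq> A" unfolding Leib_def by (intro span_minimal subspace_A) auto
  then show ?thesis using False A lie_H by (auto simp: set_prod_eq_0_iff)
qed simp

lemma unique_minimal_ideal: "minimal_ideal UNIV B \<longleftrightarrow> B = A"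
  unfolding minimal_ideal_def using ideal_A A_nonzero A_least by blast

lemma semidirect_sum_AH: "semidirect_sum UNIV A H"
  using ideal_A subalgebra_H subspace_A subspace_H sum_AH A_inter_H
  by (simp add: semidirect_sum_def direct_sum_def sum_space_def)

end

context minimal_nss_algebra
begin

text \<open>A supplement \<open>H\<close> of \<open>A\<close> meets \<open>A\<close> in an ideal,
  because \<open>A\<close> is abelian. This ideal does not contain \<open>A\<close>, so it is zero
  by leastness.\<close>

lemma splitting:
  obtains A H where "split_minimal_nss_algebra scale mult Basis A H"
proof -
  obtain A where A: "ideal UNIV A" "A \<noteq> {0}" "\<And>I. ideal UNIV I \<Longrightarrow> I \<noteq> {0} \<Longrightarrow> A \<subseteq> I"
    using least_nonzero_ideal by blast
  have A2: "set_prod A A = {0}" using A by (rule least_ideal_abelian)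
  obtain H where H: "subalgebra H" "\<not> A \<subseteq> H" "sum_space A H = UNIV"
    using ideal_supplement[OF A(1,2)] by metis
  have "l \<cdot> w \<in> A \<inter> H \<and> w \<cdot> l \<in> A \<inter> H" if w: "w \<in> A \<inter> H" for l w
  proof -
    obtain a h where l: "l = a + h" "a \<in> A" "h \<in> H" using H(3) sum_spaceE[of l A H] by blast
    have "a \<cdot> w = 0" "w \<cdot> a = 0" using A2 l w by (auto simp: set_prod_eq_0_iff)
    then show ?thesis using l w A(1) H(1) by (simp add: ideal_def subalgebra_def)
  qed
  then have "ideal UNIV (A \<inter> H)"
    using A(1) H(1) by (simp add: ideal_def subalgebra_def subspace_inter)
  then have "A \<inter> H = {0}" using A(3) H(2) by blast
  with A A2 H have "split_minimal_nss_algebra scale mult Basis A H"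
    by unfold_locales
  then show ?thesis by (rule that)
qed

end

theorem theorem3p1:
  fixes scale :: "'k::field \<Rightarrow> 'a::ab_group_add \<Rightarrow> 'a"
    and mult :: "'a \<Rightarrow> 'a \<Rightarrow> 'a"
    and Basis :: "'a set"
  assumes "leibniz_algebra scale mult"
    and "finite_dimensional_vector_space scale Basis"
    and "leibniz_algebra.solvable scale mult UNIV"
    and "leibniz_algebra.phi_free scale mult UNIV"
    and "leibniz_algebra.minimally_non_strongly_solvable scale mult UNIV"
  shows "CHAR('k) > 0 \<and>
    (\<exists>A H. leibniz_algebra.semidirect_sum scale mult UNIV A H \<and>
      (leibniz_algebra.minimal_ideal scale mult UNIV A \<and>
        (\<forall>B. leibniz_algebra.minimal_ideal scale mult UNIV B \<longrightarrow> B = A)) \<and>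
      vector_space.dim scale A \<ge> 2 \<and>
      leibniz_algebra.set_prod scale mult A A = {0} \<and>
      ((\<exists>M x. x \<in> H \<and>
          leibniz_algebra.direct_sum scale H M (module.span scale {x}) \<and>
          leibniz_algebra.minimal_ideal scale mult H M \<and>
          leibniz_algebra.set_prod scale mult M M = {0}) \<or>
        leibniz_algebra.heisenberg scale mult H) \<and>
      (leibniz_algebra.lie mult UNIV \<or>
        (\<not> leibniz_algebra.lie mult UNIV \<and>
          leibniz_algebra.lie mult H \<and>
          A = leibniz_algebra.Leib scale mult UNIV \<and>
          leibniz_algebra.set_prod scale mult A UNIV = {0})))"
proof -
  interpret leibniz_algebra scale mult by fact
  interpret finite_dimensional_vector_space scale Basis by fact
  interpret minimal_nss_algebra scale mult Basis
    by unfold_locales (use assms in auto)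
  obtain A H where "split_minimal_nss_algebra scale mult Basis A H" by (rule splitting)
  then interpret split_minimal_nss_algebra scale mult Basis A H .
  show ?thesis
  proof (rule conjI, rule conjunct1[OF char_positive_and_structure], intro exI conjI)
    show "semidirect_sum UNIV A H" by (rule semidirect_sum_AH)
    show "minimal_ideal UNIV A" "\<forall>B. minimal_ideal UNIV B \<longrightarrow> B = A"
      by (simp_all add: unique_minimal_ideal)
    show "dim A \<ge> 2" by (rule dim_A)
    show "set_prod A A = {0}" by (rule A_abelian)
  qed (rule conjunct2[OF char_positive_and_structure], rule lie_or_Leib)
qed

end
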